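(* Let $\mathbb{K}$ be a field, let $V,W$ be persistence modules over $\mathbb{K}$, and let $A:V\to V[c_A]$ and $B:W\to W[c_B]$ be morphisms of persistence modules with $c_A=c_B\in\mathbb{R}$. Then $$d_{inter}(\mathrm{im}(A),\mathrm{im}(B))\leq d_{\mathrm{op\text{-}inter}}((V,A),(W,B)).$$
   Context: Persistence modules. A persistence module $(V,\pi)$ over $\mathbb{K}$ is a family of finite-dimensional $\mathbb{K}$-vector spaces $\{V^t\}_{t\in\mathbb{R}}$ with linear maps $\pi_{s,t}:V^s\to V^t$ for $s<t$ (with $\pi_{t,t}=\mathrm{id}$) such that: $V^t=0$ for $t\ll0$ and $\pi_{s,t}$ is an isomorphism for all $s,t$ sufficiently large; $\pi_{t,r}\circ\pi_{s,t}=\pi_{s,r}$ for $s<t<r$; for every $r\in\mathbb{R}$ there is $\varepsilon>0$ such that $\pi_{s,t}$ is an isomorphism for all $r-\varepsilon<s<t\leq r$; and for all but finitely many $r\in\mathbb{R}$ there is a neighbourhood $U$ of $r$ such that $\pi_{s,t}$ is an isomorphism for all $s<t$ in $U$. A morphism $F:V\to W$ is a family of linear maps $F_t:V^t\to W^t$ commuting with the structure maps. Its image $\mathrm{im}(F)$ is the persistence module $\{\mathrm{im}\,F_t\subset W^t\}_{t}$ with restricted structure maps. Shifts. For $\delta\in\mathbb{R}$, $V[\delta]$ is the persistence module $V[\delta]^t=V^{t+\delta}$ with structure maps $\pi_{s+\delta,t+\delta}$. A morphism $F:V\to W$ induces $F[\delta]:V[\delta]\to W[\delta]$. For $\delta\geq0$,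 $sh(\delta)_V:V\to V[\delta]$ is given by $\pi_{t,t+\delta}$. For $A:V\to V[c_A]$, the image $\mathrm{im}(A)$ is a persistence submodule of $V[c_A]$. Interleavings. A $\delta$-interleaving between $V$ and $W$ is a pair of morphisms $f:V\to W[\delta]$, $g:W\to V[\delta]$ with $g[\delta]\circ f=sh(2\delta)_V$ and $f[\delta]\circ g=sh(2\delta)_W$. $d_{inter}(V,W)$ is the infimum of all $\delta>0$ such that a $\delta$-interleaving exists. Operator interleavings. For pairs $(V,A)$, $(W,B)$ with $c_A=c_B$ and $\delta\geq0$, an operator-$\delta$-interleaving is a $\delta$-interleaving $f:V\to W[\delta]$, $g:W\to V[\delta]$ with $$f[c_A]\circ A=B[\delta]\circ f,\qquad g[c_B]\circ B=A[\delta]\circ g.$$ $d_{\mathrm{op\text{-}inter}}((V,A),(W,B))$ is the infimum of all $\delta\geq0$ such that an operator-$\delta$-interleaving exists. An infimum over the empty set is $+\infty$. *)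

theory Defs
  imports "Jordan_Normal_Form.Missing_VectorSpace" "HOL-Library.Extended_Real"
begin

text \<open>
  Vector spaces, linear maps and finite dimension are those of the AFP entry VectorSpace, on top of
  the carrier-based modules of HOL-Algebra. Maps are total functions whose values outside the
  carriers are irrelevant, so equality of maps always means equality on the carrier of the source.
\<close>

definition linear_iso ::
    "('k, 'm) ring_scheme \<Rightarrow> ('k, 'a) module \<Rightarrow> ('k, 'b) module \<Rightarrow> ('a \<Rightarrow> 'b) \<Rightarrow> bool" where
  "linear_iso K X Y T \<longleftrightarrow> linear_map K X Y T \<and> bij_betw T (carrier X) (carrier Y)"


subsection \<open>Persistence modules\<close>

text \<open>
  The fibres of a persistence module share one element type, but each has its own carrier, zero and
  operations; this does not restrict the families of vector spaces up to isomorphism.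
  The value \<open>transition V s t\<close> is meaningful for \<open>s \<le> t\<close> only.
\<close>

record ('k, 'a) pers_mod =
  fibre :: "real \<Rightarrow> ('k, 'a) module"
  transition :: "real \<Rightarrow> real \<Rightarrow> 'a \<Rightarrow> 'a"

abbreviation transition_iso ::
    "('k, 'm) ring_scheme \<Rightarrow> ('k, 'a) pers_mod \<Rightarrow> real \<Rightarrow> real \<Rightarrow> bool" where
  "transition_iso K V s t \<equiv> linear_iso K (fibre V s) (fibre V t) (transition V s t)"

locale persistence_module =
  fixes K :: "('k, 'm) ring_scheme" and V :: "('k, 'a) pers_mod"
  assumes vectorspace_fibre: "vectorspace K (fibre V t)"
    and fin_dim_fibre: "vectorspace.fin_dim K (fibre V t)"
    and linear_transition:
      "s < t \<Longrightarrow> linear_map K (fibre V s) (fibre V t) (transition V s t)"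
    and transition_refl: "v \<in> carrier (fibre V t) \<Longrightarrow> transition V t t v = v"
    and transition_trans:
      "\<lbrakk>s < t; t < r; v \<in> carrier (fibre V s)\<rbrakk>
        \<Longrightarrow> transition V t r (transition V s t v) = transition V s r v"
    and eventually_zero: "\<exists>T. \<forall>t\<le>T. carrier (fibre V t) = {\<zero>\<^bsub>fibre V t\<^esub>}"
    and eventually_iso: "\<exists>T. \<forall>s t. T \<le> s \<and> s < t \<longrightarrow> transition_iso K V s t"
    and left_semicontinuous:
      "\<exists>\<epsilon>>0. \<forall>s t. r - \<epsilon> < s \<and> s < t \<and> t \<le> r \<longrightarrow> transition_iso K V s t"
    and finite_spectrum:
      "finite {r. \<not> (\<exists>U. open U \<and> r \<in> U \<and>
          (\<forall>s\<in>U. \<forall>t\<in>U. s < t \<longrightarrow> transition_iso K V s t))}"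

definition shift :: "real \<Rightarrow> ('k, 'a) pers_mod \<Rightarrow> ('k, 'a) pers_mod" where
  "shift \<delta> V = \<lparr>fibre = (\<lambda>t. fibre V (t + \<delta>)),
                transition = (\<lambda>s t. transition V (s + \<delta>) (t + \<delta>))\<rparr>"


lemma persistence_module_shift:
  assumes "persistence_module K V"
  shows "persistence_module K (shift \<delta> V)"
proof -
  interpret persistence_module K V by fact
  have finite_shifted: "finite {r. \<not> Q r}"
    if "finite {r. \<not> P r}" "\<And>r. P (r + \<delta>) \<Longrightarrow> Q r" for P Q :: "real \<Rightarrow> bool"
  proof (rule finite_subset)
    show "{r. \<not> Q r} \<subseteq> (\<lambda>r. r + \<delta>) -` {r. \<not> P r}" using that(2) by auto
    show "finite ((\<lambda>r. r + \<delta>) -` {r. \<not> P r})"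
      using that(1) by (rule finite_vimageI) simp
  qed
  let ?good = "\<lambda>V r. \<exists>U. open U \<and> r \<in> U \<and>
    (\<forall>s\<in>U. \<forall>t\<in>U. s < t \<longrightarrow> transition_iso K V s t)"
  show ?thesis
  proof (rule persistence_module.intro, goal_cases)
    case (1 t)
    then show ?case using vectorspace_fibre by (simp add: shift_def)
  next
    case (2 t)
    then show ?case using fin_dim_fibre by (simp add: shift_def)
  next
    case (3 s t)
    then show ?case using linear_transition by (simp add: shift_def)
  next
    case (4 v t)
    then show ?case using transition_refl by (simp add: shift_def)
  next
    case (5 s t r v)
    then show ?case using transition_trans by (simp add: shift_def)
  next
    case 6
    obtain T where T: "\<forall>t\<le>T. carrier (fibre V t) = {\<zero>\<^bsub>fibre V t\<^esub>}"
      using eventually_zero by blast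
    show ?case by (rule exI[of _ "T - \<delta>"]) (use T in \<open>simp add: shift_def\<close>)
  next
    case 7
    obtain T where T: "\<forall>s t. T \<le> s \<and> s < t \<longrightarrow> transition_iso K V s t"
      using eventually_iso by blast
    show ?case by (rule exI[of _ "T - \<delta>"]) (use T in \<open>simp add: shift_def\<close>)
  next
    case (8 r)
    obtain e where "e > 0" and
      e: "\<forall>s t. (r + \<delta>) - e < s \<and> s < t \<and> t \<le> r + \<delta> \<longrightarrow> transition_iso K V s t"
      using left_semicontinuous by blast
    show ?case by (rule exI[of _ e]) (use \<open>e > 0\<close> e in \<open>simp add: shift_def\<close>)
  next
    case 9
    have "?good (shift \<delta> V) r" if good: "?good V (r + \<delta>)" for r
    proof -
      obtain U where U: "open U" "r + \<delta> \<in> U"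
        "\<forall>s\<in>U. \<forall>t\<in>U. s < t \<longrightarrow> transition_iso K V s t" using good by blast
      have "open ((\<lambda>x. x + \<delta>) -` U)"
        using U(1) by (rule open_vimage) (intro continuous_intros)
      then show ?thesis
        by (intro exI[of _ "(\<lambda>x. x + \<delta>) -` U"]) (use U in \<open>auto simp: shift_def\<close>)
    qed
    then show ?case by (rule finite_shifted[OF finite_spectrum])
  qed
qed


subsection \<open>Morphisms\<close>

definition morphism ::
    "('k, 'm) ring_scheme \<Rightarrow> ('k, 'a) pers_mod \<Rightarrow> ('k, 'b) pers_mod
      \<Rightarrow> (real \<Rightarrow> 'a \<Rightarrow> 'b) \<Rightarrow> bool" where
  "morphism K V W F \<longleftrightarrow>
     (\<forall>t. linear_map K (fibre V t) (fibre W t) (F t)) \<and>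
     (\<forall>s t. s < t \<longrightarrow> (\<forall>v\<in>carrier (fibre V s).
        F t (transition V s t v) = transition W s t (F s v)))"

definition eq_morphism ::
    "('k, 'a) pers_mod \<Rightarrow> (real \<Rightarrow> 'a \<Rightarrow> 'b) \<Rightarrow> (real \<Rightarrow> 'a \<Rightarrow> 'b) \<Rightarrow> bool" where
  "eq_morphism V F G \<longleftrightarrow> (\<forall>t. \<forall>v\<in>carrier (fibre V t). F t v = G t v)"

definition comp_morphism ::
    "(real \<Rightarrow> 'b \<Rightarrow> 'c) \<Rightarrow> (real \<Rightarrow> 'a \<Rightarrow> 'b) \<Rightarrow> real \<Rightarrow> 'a \<Rightarrow> 'c" where
  "comp_morphism G F = (\<lambda>t. G t \<circ> F t)"

definition shift_morphism :: "real \<Rightarrow> (real \<Rightarrow> 'a \<Rightarrow> 'b) \<Rightarrow> real \<Rightarrow> 'a \<Rightarrow> 'b" where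
  "shift_morphism \<delta> F = (\<lambda>t. F (t + \<delta>))"

definition sh :: "real \<Rightarrow> ('k, 'a) pers_mod \<Rightarrow> real \<Rightarrow> 'a \<Rightarrow> 'a" where
  "sh \<delta> V = (\<lambda>t. transition V t (t + \<delta>))"

text \<open>The image of \<open>F : V \<rightarrow> W\<close>, as a persistence submodule of \<open>W\<close>.\<close>

definition image_pers_mod ::
    "('k, 'a) pers_mod \<Rightarrow> ('k, 'b) pers_mod \<Rightarrow> (real \<Rightarrow> 'a \<Rightarrow> 'b) \<Rightarrow> ('k, 'b) pers_mod" where
  "image_pers_mod V W F =
     \<lparr>fibre = (\<lambda>t. (fibre W t)\<lparr>carrier := F t ` carrier (fibre V t)\<rparr>),
      transition = transition W\<rparr>"


lemma linear_map_image:
  assumes "linear_map K X Y T"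
  shows "linear_map K X (Y\<lparr>carrier := T ` carrier X\<rparr>) T"
    and "vectorspace K (Y\<lparr>carrier := T ` carrier X\<rparr>)"
    and "vectorspace.fin_dim K X \<Longrightarrow> vectorspace.fin_dim K (Y\<lparr>carrier := T ` carrier X\<rparr>)"
proof -
  interpret T: linear_map K X Y T by fact
  let ?I = "Y\<lparr>carrier := T ` carrier X\<rparr>"
  have "VectorSpace.subspace K (T ` carrier X) Y"
    using T.imT_is_subspace by (simp add: T.im_def)
  then show vs: "vectorspace K ?I" by (rule T.W.subspace_is_vs)
  have "T \<in> LinearCombinations.module_hom K X ?I"
    using T.T_hom by (auto simp: LinearCombinations.module_hom_def)
  then show lin: "linear_map K X ?I T"
    by (intro linear_map.intro mod_hom.intro mod_hom_axioms.intro vs T.V.vectorspace_axioms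
        vectorspace.axioms(1))
  show "vectorspace.fin_dim K ?I" if "vectorspace.fin_dim K X"
    using linear_map.surj_fin_dim[OF lin that] by simp
qed

lemma linear_map_between_images:
  assumes S: "linear_map K X X' S" and T: "linear_map K Y Y' T"
    and F: "linear_map K X Y F" and F': "linear_map K X' Y' F'"
    and comm: "\<forall>x\<in>carrier X. F' (S x) = T (F x)"
  shows "linear_map K (Y\<lparr>carrier := F ` carrier X\<rparr>) (Y'\<lparr>carrier := F' ` carrier X'\<rparr>) T"
proof -
  interpret S: linear_map K X X' S by fact
  interpret T: linear_map K Y Y' T by fact
  interpret F: linear_map K X Y F by fact
  let ?I = "Y\<lparr>carrier := F ` carrier X\<rparr>" and ?I' = "Y'\<lparr>carrier := F' ` carrier X'\<rparr>"
  note vs = linear_map_image(2)[OF F] linear_map_image(2)[OF F']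
  have "T (F x) \<in> F' ` carrier X'" if "x \<in> carrier X" for x
    using that comm S.f_im[OF that] by (metis imageI)
  then have "T \<in> LinearCombinations.module_hom K ?I ?I'"
    using T.T_hom F.T_hom by (auto simp: LinearCombinations.module_hom_def Pi_iff)
  then show ?thesis
    by (intro linear_map.intro mod_hom.intro mod_hom_axioms.intro vs vectorspace.axioms(1))
qed

lemma persistence_module_image:
  assumes V: "persistence_module K V" and W: "persistence_module K W" and F: "morphism K V W F"
  shows "persistence_module K (image_pers_mod V W F)"
proof -
  interpret V: persistence_module K V by fact
  interpret W: persistence_module K W by fact
  let ?I = "image_pers_mod V W F"
  have linF: "linear_map K (fibre V t) (fibre W t) (F t)" for t
    using F by (simp add: morphism_def)
  have nat: "\<forall>v\<in>carrier (fibre V s). F t (transition V s t v) = transition W s t (F s v)"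
    if "s < t" for s t using F that by (simp add: morphism_def)
  have Fc: "F t v \<in> carrier (fibre W t)" if "v \<in> carrier (fibre V t)" for t v
    using module_hom_closed[OF linear_map.T_hom[OF linF]] that by blast
  have lin: "linear_map K (fibre ?I s) (fibre ?I t) (transition ?I s t)" if "s < t" for s t
    using linear_map_between_images[OF V.linear_transition[OF that] W.linear_transition[OF that]
        linF linF nat[OF that]] by (simp add: image_pers_mod_def)
  have iso: "transition_iso K ?I s t"
    if "s < t" and v: "transition_iso K V s t" and w: "transition_iso K W s t" for s t
  proof -
    have "transition W s t ` F s ` carrier (fibre V s)
        = F t ` transition V s t ` carrier (fibre V s)"
      unfolding image_image using nat[OF \<open>s < t\<close>] by (intro image_cong) auto
    also have "transition V s t ` carrier (fibre V s) = carrier (fibre V t)"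
      using v by (simp add: linear_iso_def bij_betw_def)
    finally have "transition W s t ` F s ` carrier (fibre V s) = F t ` carrier (fibre V t)" .
    moreover have "inj_on (transition W s t) (F s ` carrier (fibre V s))"
      using w Fc by (auto simp: linear_iso_def bij_betw_def intro: inj_on_subset)
    ultimately show ?thesis
      using lin[OF \<open>s < t\<close>] by (simp add: linear_iso_def bij_betw_def image_pers_mod_def)
  qed
  have finite_union: "finite {r. \<not> R r}"
    if "finite {r. \<not> P r}" "finite {r. \<not> Q r}" "\<And>r. P r \<Longrightarrow> Q r \<Longrightarrow> R r"
    for P Q R :: "real \<Rightarrow> bool"
  proof (rule finite_subset)
    show "{r. \<not> R r} \<subseteq> {r. \<not> P r} \<union> {r. \<not> Q r}" using that(3) by auto
    show "finite ({r. \<not> P r} \<union> {r. \<not> Q r})" using that by simp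
  qed
  let ?good = "\<lambda>V r. \<exists>U. open U \<and> r \<in> U \<and>
    (\<forall>s\<in>U. \<forall>t\<in>U. s < t \<longrightarrow> transition_iso K V s t)"
  show ?thesis
  proof (rule persistence_module.intro, goal_cases)
    case (1 t)
    then show ?case using linear_map_image(2)[OF linF] by (simp add: image_pers_mod_def)
  next
    case (2 t)
    then show ?case
      using linear_map_image(3)[OF linF V.fin_dim_fibre] by (simp add: image_pers_mod_def)
  next
    case (3 s t)
    then show ?case by (rule lin)
  next
    case (4 v t)
    then show ?case using W.transition_refl Fc by (auto simp: image_pers_mod_def)
  next
    case (5 s t r v)
    then show ?case using W.transition_trans Fc by (auto simp: image_pers_mod_def)
  next
    case 6
    obtain T where T: "\<forall>t\<le>T. carrier (fibre V t) = {\<zero>\<^bsub>fibre V t\<^esub>}"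
      using V.eventually_zero by blast
    have "F t \<zero>\<^bsub>fibre V t\<^esub> = \<zero>\<^bsub>fibre W t\<^esub>" for t
      by (rule linear_map.T0_is_0[OF linF])
    with T show ?case by (intro exI[of _ T]) (simp add: image_pers_mod_def)
  next
    case 7
    obtain T where T: "\<forall>s t. T \<le> s \<and> s < t \<longrightarrow> transition_iso K V s t"
      using V.eventually_iso by blast
    obtain T' where T': "\<forall>s t. T' \<le> s \<and> s < t \<longrightarrow> transition_iso K W s t"
      using W.eventually_iso by blast
    show ?case by (rule exI[of _ "max T T'"]) (use T T' iso in auto)
  next
    case (8 r)
    obtain d where d: "d > 0"
      "\<forall>s t. r - d < s \<and> s < t \<and> t \<le> r \<longrightarrow> transition_iso K V s t"
      using V.left_semicontinuous by blast
    obtain e where e: "e > 0"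
      "\<forall>s t. r - e < s \<and> s < t \<and> t \<le> r \<longrightarrow> transition_iso K W s t"
      using W.left_semicontinuous by blast
    show ?case by (rule exI[of _ "min d e"]) (use d e iso in auto)
  next
    case 9
    have "?good ?I r" if good: "?good V r" "?good W r" for r
    proof -
      obtain U where U: "open U" "r \<in> U"
        "\<forall>s\<in>U. \<forall>t\<in>U. s < t \<longrightarrow> transition_iso K V s t" using good(1) by blast
      obtain U' where U': "open U'" "r \<in> U'"
        "\<forall>s\<in>U'. \<forall>t\<in>U'. s < t \<longrightarrow> transition_iso K W s t" using good(2) by blast
      show ?thesis by (rule exI[of _ "U \<inter> U'"]) (use U U' iso in auto)
    qed
    then show ?case by (rule finite_union[OF V.finite_spectrum W.finite_spectrum])
  qed
qed


subsection \<open>Interleavings\<close>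

definition interleaving ::
    "('k, 'm) ring_scheme \<Rightarrow> real \<Rightarrow> ('k, 'a) pers_mod \<Rightarrow> ('k, 'b) pers_mod
      \<Rightarrow> (real \<Rightarrow> 'a \<Rightarrow> 'b) \<Rightarrow> (real \<Rightarrow> 'b \<Rightarrow> 'a) \<Rightarrow> bool" where
  "interleaving K \<delta> V W f g \<longleftrightarrow>
     morphism K V (shift \<delta> W) f \<and>
     morphism K W (shift \<delta> V) g \<and>
     eq_morphism V (comp_morphism (shift_morphism \<delta> g) f) (sh (2 * \<delta>) V) \<and>
     eq_morphism W (comp_morphism (shift_morphism \<delta> f) g) (sh (2 * \<delta>) W)"

definition d_inter ::
    "('k, 'm) ring_scheme \<Rightarrow> ('k, 'a) pers_mod \<Rightarrow> ('k, 'b) pers_mod \<Rightarrow> ereal" where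
  "d_inter K V W = Inf {ereal \<delta> | \<delta>. \<delta> > 0 \<and> (\<exists>f g. interleaving K \<delta> V W f g)}"

definition op_interleaving ::
    "('k, 'm) ring_scheme \<Rightarrow> real
      \<Rightarrow> ('k, 'a) pers_mod \<Rightarrow> real \<Rightarrow> (real \<Rightarrow> 'a \<Rightarrow> 'a)
      \<Rightarrow> ('k, 'b) pers_mod \<Rightarrow> real \<Rightarrow> (real \<Rightarrow> 'b \<Rightarrow> 'b)
      \<Rightarrow> (real \<Rightarrow> 'a \<Rightarrow> 'b) \<Rightarrow> (real \<Rightarrow> 'b \<Rightarrow> 'a) \<Rightarrow> bool" where
  "op_interleaving K \<delta> V cA A W cB B f g \<longleftrightarrow>
     interleaving K \<delta> V W f g \<and>
     eq_morphism V (comp_morphism (shift_morphism cA f) A) (comp_morphism (shift_morphism \<delta> B) f) \<and>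
     eq_morphism W (comp_morphism (shift_morphism cB g) B) (comp_morphism (shift_morphism \<delta> A) g)"

text \<open>Only meaningful for \<open>A : V \<rightarrow> V[cA]\<close> and \<open>B : W \<rightarrow> W[cB]\<close> with \<open>cA = cB\<close>.\<close>

definition d_op_inter ::
    "('k, 'm) ring_scheme
      \<Rightarrow> ('k, 'a) pers_mod \<Rightarrow> real \<Rightarrow> (real \<Rightarrow> 'a \<Rightarrow> 'a)
      \<Rightarrow> ('k, 'b) pers_mod \<Rightarrow> real \<Rightarrow> (real \<Rightarrow> 'b \<Rightarrow> 'b) \<Rightarrow> ereal" where
  "d_op_inter K V cA A W cB B =
     Inf {ereal \<delta> | \<delta>. \<delta> \<ge> 0 \<and> (\<exists>f g. op_interleaving K \<delta> V cA A W cB B f g)}"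

end

theory Submission
  imports Defs
begin

text \<open>
  Let \<open>f : V \<rightarrow> W[\<delta>]\<close> and \<open>g : W \<rightarrow> V[\<delta>]\<close> be an operator-\<open>\<delta>\<close>-interleaving and \<open>c\<close> the common
  shift of \<open>A\<close> and \<open>B\<close>. Since \<open>f[c] \<circ> A = B[\<delta>] \<circ> f\<close>, the morphism \<open>f[c]\<close> sends \<open>im A \<subseteq> V[c]\<close> into
  \<open>(im B)[\<delta>] \<subseteq> W[c + \<delta>]\<close>; likewise \<open>g[c]\<close> sends \<open>im B\<close> into \<open>(im A)[\<delta>]\<close>. The interleaving
  identities for \<open>f[c]\<close>, \<open>g[c]\<close> are those for \<open>f\<close>, \<open>g\<close> at the parameter \<open>t + c\<close>, and they survive
  restriction to submodules. So the images are \<open>\<delta>\<close>-interleaved (\<open>op_interleaving_images\<close>).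

  The two infima range over different sets: \<open>d_op_inter\<close> admits \<open>\<delta> = 0\<close>, whereas \<open>d_inter\<close> requires
  \<open>\<delta> > 0\<close>. An interleaving can be relaxed to any larger parameter (\<open>interleaving_relax\<close>), so the
  images are \<open>\<epsilon>\<close>-interleaved for every \<open>\<epsilon> > \<delta>\<close>, and letting \<open>\<epsilon>\<close> tend to \<open>\<delta>\<close> covers \<open>\<delta> = 0\<close> as well.
\<close>

lemma linear_map_comp:
  assumes S: "linear_map K X Y S" and T: "linear_map K Y Z T"
  shows "linear_map K X Z (T \<circ> S)"
proof -
  interpret S: linear_map K X Y S by fact
  interpret T: linear_map K Y Z T by fact
  have "T \<circ> S \<in> LinearCombinations.module_hom K X Z"
    using S.T_hom T.T_hom by (auto simp: LinearCombinations.module_hom_def Pi_iff)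
  then show ?thesis
    by (intro linear_map.intro mod_hom.intro mod_hom_axioms.intro
        S.V.vectorspace_axioms T.W.vectorspace_axioms vectorspace.axioms(1))
qed

lemma fibre_shift [simp]: "fibre (shift \<delta> V) t = fibre V (t + \<delta>)"
  by (simp add: shift_def)

lemma transition_shift [simp]: "transition (shift \<delta> V) s t = transition V (s + \<delta>) (t + \<delta>)"
  by (simp add: shift_def)

lemma fibre_image_pers_mod [simp]:
  "fibre (image_pers_mod V W F) t = (fibre W t)\<lparr>carrier := F t ` carrier (fibre V t)\<rparr>"
  by (simp add: image_pers_mod_def)

lemma transition_image_pers_mod [simp]: "transition (image_pers_mod V W F) = transition W"
  by (simp add: image_pers_mod_def)

lemma morphism_linear:
  "morphism K V W F \<Longrightarrow> linear_map K (fibre V t) (fibre W t) (F t)"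
  by (simp add: morphism_def)

lemma morphism_natural:
  "\<lbrakk>morphism K V W F; s < t; v \<in> carrier (fibre V s)\<rbrakk>
    \<Longrightarrow> F t (transition V s t v) = transition W s t (F s v)"
  by (simp add: morphism_def)

lemma morphism_closed:
  "\<lbrakk>morphism K V W F; v \<in> carrier (fibre V t)\<rbrakk> \<Longrightarrow> F t v \<in> carrier (fibre W t)"
  using module_hom_closed[OF linear_map.T_hom[OF morphism_linear]] by blast

lemma (in persistence_module) transition_trans_le:
  assumes "s \<le> t" and "t < r" and "v \<in> carrier (fibre V s)"
  shows "transition V t r (transition V s t v) = transition V s r v"
  using assms transition_refl transition_trans by (cases "s = t") auto

definition relax ::
    "real \<Rightarrow> real \<Rightarrow> ('k, 'b) pers_mod \<Rightarrow> (real \<Rightarrow> 'a \<Rightarrow> 'b) \<Rightarrow> real \<Rightarrow> 'a \<Rightarrow> 'b" where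
  "relax \<delta> \<epsilon> W f = (\<lambda>t. transition W (t + \<delta>) (t + \<epsilon>) \<circ> f t)"

lemma morphism_relax:
  assumes W: "persistence_module K W" and f: "morphism K V (shift \<delta> W) f" and "\<delta> < \<epsilon>"
  shows "morphism K V (shift \<epsilon> W) (relax \<delta> \<epsilon> W f)"
  unfolding morphism_def
proof (intro conjI allI impI ballI)
  interpret W: persistence_module K W by fact
  fix t
  show "linear_map K (fibre V t) (fibre (shift \<epsilon> W) t) (relax \<delta> \<epsilon> W f t)"
    unfolding relax_def fibre_shift
    by (rule linear_map_comp[OF morphism_linear[OF f, unfolded fibre_shift]
          W.linear_transition]) (use \<open>\<delta> < \<epsilon>\<close> in simp)
next
  interpret W: persistence_module K W by fact
  fix s t v assume st: "s < t" and v: "v \<in> carrier (fibre V s)"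
  have fv: "f s v \<in> carrier (fibre W (s + \<delta>))" using morphism_closed[OF f v] by simp
  show "relax \<delta> \<epsilon> W f t (transition V s t v)
      = transition (shift \<epsilon> W) s t (relax \<delta> \<epsilon> W f s v)"
    \<comment> \<open>Both sides are the transition of \<open>W\<close> from \<open>s + \<delta>\<close> to \<open>t + \<epsilon>\<close> applied to \<open>f s v\<close>.\<close>
    using morphism_natural[OF f st v] W.transition_trans[OF _ _ fv, of "t + \<delta>" "t + \<epsilon>"]
      W.transition_trans[OF _ _ fv, of "s + \<epsilon>" "t + \<epsilon>"] st \<open>\<delta> < \<epsilon>\<close>
    by (simp add: relax_def)
qed

text \<open>
  By naturality of \<open>g\<close>, the composite of the relaxed morphisms is \<open>g[\<delta>] \<circ> f\<close>, which is the
  transition by \<open>2\<delta>\<close>, followed by two transitions by \<open>\<epsilon> - \<delta>\<close>; together they are the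
  transition by \<open>2\<epsilon>\<close>.
\<close>

lemma comp_relax:
  assumes V: "persistence_module K V" and W: "persistence_module K W"
    and f: "morphism K V (shift \<delta> W) f" and g: "morphism K W (shift \<delta> V) g"
    and gf: "eq_morphism V (comp_morphism (shift_morphism \<delta> g) f) (sh (2 * \<delta>) V)"
    and "0 \<le> \<delta>" "\<delta> < \<epsilon>"
  shows "eq_morphism V (comp_morphism (shift_morphism \<epsilon> (relax \<delta> \<epsilon> V g)) (relax \<delta> \<epsilon> W f))
    (sh (2 * \<epsilon>) V)"
  unfolding eq_morphism_def
proof (intro allI ballI)
  interpret V: persistence_module K V by fact
  fix t v assume v: "v \<in> carrier (fibre V t)"
  have fv: "f t v \<in> carrier (fibre W (t + \<delta>))" using morphism_closed[OF f v] by simp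
  have gfv: "g (t + \<delta>) (f t v) = transition V t (t + 2 * \<delta>) v"
    using gf v by (simp add: eq_morphism_def comp_morphism_def shift_morphism_def sh_def)
  have "comp_morphism (shift_morphism \<epsilon> (relax \<delta> \<epsilon> V g)) (relax \<delta> \<epsilon> W f) t v
      = transition V (t + \<epsilon> + \<delta>) (t + \<epsilon> + \<epsilon>) (g (t + \<epsilon>) (transition W (t + \<delta>) (t + \<epsilon>) (f t v)))"
    by (simp add: comp_morphism_def shift_morphism_def relax_def)
  also have "g (t + \<epsilon>) (transition W (t + \<delta>) (t + \<epsilon>) (f t v))
      = transition V (t + 2 * \<delta>) (t + \<epsilon> + \<delta>) (transition V t (t + 2 * \<delta>) v)"
    using morphism_natural[OF g _ fv, of "t + \<epsilon>"] gfv \<open>\<delta> < \<epsilon>\<close> by (simp add: add.assoc)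
  also have "\<dots> = transition V t (t + \<epsilon> + \<delta>) v"
    by (rule V.transition_trans_le[OF _ _ v]) (use \<open>0 \<le> \<delta>\<close> \<open>\<delta> < \<epsilon>\<close> in simp_all)
  also have "transition V (t + \<epsilon> + \<delta>) (t + \<epsilon> + \<epsilon>) \<dots> = transition V t (t + \<epsilon> + \<epsilon>) v"
    by (rule V.transition_trans[OF _ _ v]) (use \<open>0 \<le> \<delta>\<close> \<open>\<delta> < \<epsilon>\<close> in simp_all)
  finally show "comp_morphism (shift_morphism \<epsilon> (relax \<delta> \<epsilon> V g)) (relax \<delta> \<epsilon> W f) t v
      = sh (2 * \<epsilon>) V t v"
    by (simp add: sh_def add.assoc)
qed

lemma interleaving_relax:
  assumes V: "persistence_module K V" and W: "persistence_module K W"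
    and "interleaving K \<delta> V W f g" and "0 \<le> \<delta>" "\<delta> < \<epsilon>"
  shows "interleaving K \<epsilon> V W (relax \<delta> \<epsilon> W f) (relax \<delta> \<epsilon> V g)"
  using assms(3-5) morphism_relax[OF W] morphism_relax[OF V] comp_relax[OF V W] comp_relax[OF W V]
  unfolding interleaving_def by blast

text \<open>
  The intertwining relation gives \<open>f[c] (A v) = B[\<delta>] (f v)\<close>, so \<open>f[c]\<close> carries the image of \<open>A\<close>
  into the shifted image of \<open>B\<close>; linearity and naturality are inherited from \<open>f\<close>.
\<close>

lemma morphism_between_images:
  assumes V: "persistence_module K V" and W: "persistence_module K W"
    and A: "morphism K V (shift c V) A" and B: "morphism K W (shift c W) B"
    and f: "morphism K V (shift \<delta> W) f"
    and fA: "eq_morphism V (comp_morphism (shift_morphism c f) A)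
      (comp_morphism (shift_morphism \<delta> B) f)"
  shows "morphism K (image_pers_mod V (shift c V) A) (shift \<delta> (image_pers_mod W (shift c W) B))
    (shift_morphism c f)"
  unfolding morphism_def
proof (intro conjI allI impI ballI)
  fix t
  have "linear_map K (fibre V (t + c)) (fibre W (t + \<delta> + c)) (f (t + c))"
    using morphism_linear[OF f, of "t + c"] by (simp add: ac_simps)
  moreover have "\<forall>v\<in>carrier (fibre V t). f (t + c) (A t v) = B (t + \<delta>) (f t v)"
    using fA by (simp add: eq_morphism_def comp_morphism_def shift_morphism_def)
  ultimately show "linear_map K (fibre (image_pers_mod V (shift c V) A) t)
      (fibre (shift \<delta> (image_pers_mod W (shift c W) B)) t) (shift_morphism c f t)"
    using linear_map_between_images[OF morphism_linear[OF f, of t, unfolded fibre_shift] _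
        morphism_linear[OF A, of t, unfolded fibre_shift]
        morphism_linear[OF B, of "t + \<delta>", unfolded fibre_shift]]
    by (simp add: shift_morphism_def)
next
  fix s t v assume "s < t" and "v \<in> carrier (fibre (image_pers_mod V (shift c V) A) s)"
  then have "v \<in> carrier (fibre V (s + c))"
    using morphism_closed[OF A] by auto
  with \<open>s < t\<close> show "shift_morphism c f t (transition (image_pers_mod V (shift c V) A) s t v)
      = transition (shift \<delta> (image_pers_mod W (shift c W) B)) s t (shift_morphism c f s v)"
    using morphism_natural[OF f, of "s + c" "t + c" v]
    by (simp add: shift_morphism_def ac_simps)
qed

lemma comp_between_images:
  assumes A: "morphism K V (shift c V) A"
    and gf: "eq_morphism V (comp_morphism (shift_morphism \<delta> g) f) (sh (2 * \<delta>) V)"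
  shows "eq_morphism (image_pers_mod V (shift c V) A)
    (comp_morphism (shift_morphism \<delta> (shift_morphism c g)) (shift_morphism c f))
    (sh (2 * \<delta>) (image_pers_mod V (shift c V) A))"
  unfolding eq_morphism_def
proof (intro allI ballI)
  fix t v assume "v \<in> carrier (fibre (image_pers_mod V (shift c V) A) t)"
  then have "v \<in> carrier (fibre V (t + c))"
    using morphism_closed[OF A] by auto
  then have "g (t + c + \<delta>) (f (t + c) v) = transition V (t + c) (t + c + 2 * \<delta>) v"
    using gf by (simp add: eq_morphism_def comp_morphism_def shift_morphism_def sh_def)
  then show "comp_morphism (shift_morphism \<delta> (shift_morphism c g)) (shift_morphism c f) t v
      = sh (2 * \<delta>) (image_pers_mod V (shift c V) A) t v"
    by (simp add: comp_morphism_def shift_morphism_def sh_def ac_simps)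
qed

lemma op_interleaving_images:
  assumes V: "persistence_module K V" and W: "persistence_module K W"
    and A: "morphism K V (shift c V) A" and B: "morphism K W (shift c W) B"
    and op: "op_interleaving K \<delta> V c A W c B f g"
  shows "interleaving K \<delta> (image_pers_mod V (shift c V) A) (image_pers_mod W (shift c W) B)
    (shift_morphism c f) (shift_morphism c g)"
  using op morphism_between_images[OF V W A B] morphism_between_images[OF W V B A]
    comp_between_images[OF A] comp_between_images[OF B]
  unfolding op_interleaving_def interleaving_def by blast

theorem proposition2p14:
  fixes K :: "('k, 'm) ring_scheme"
    and V :: "('k, 'a) pers_mod" and W :: "('k, 'b) pers_mod"
    and cA cB :: real
    and A :: "real \<Rightarrow> 'a \<Rightarrow> 'a" and B :: "real \<Rightarrow> 'b \<Rightarrow> 'b"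
  assumes "field K"
    and "persistence_module K V" and "persistence_module K W"
    and "morphism K V (shift cA V) A" and "morphism K W (shift cB W) B"
    and "cA = cB"
  shows "d_inter K (image_pers_mod V (shift cA V) A) (image_pers_mod W (shift cB W) B)
           \<le> d_op_inter K V cA A W cB B"
proof -
  let ?I = "image_pers_mod V (shift cA V) A" and ?J = "image_pers_mod W (shift cB W) B"
  note I = persistence_module_image[OF assms(2) persistence_module_shift[OF assms(2)] assms(4)]
  note J = persistence_module_image[OF assms(3) persistence_module_shift[OF assms(3)] assms(5)]
  have "d_inter K ?I ?J \<le> ereal \<delta>"
    if "0 \<le> \<delta>" and op: "op_interleaving K \<delta> V cA A W cB B f g" for \<delta> f g
  proof (rule ereal_le_epsilon2)
    fix e :: real assume "0 < e"
    have "interleaving K \<delta> ?I ?J (shift_morphism cB f) (shift_morphism cB g)"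
      using op_interleaving_images assms op by blast
    then have "\<exists>f' g'. interleaving K (\<delta> + e) ?I ?J f' g'"
      using interleaving_relax[OF I J] \<open>0 \<le> \<delta>\<close> \<open>0 < e\<close> by (meson less_add_same_cancel1)
    then show "d_inter K ?I ?J \<le> ereal \<delta> + ereal e"
      unfolding d_inter_def using \<open>0 \<le> \<delta>\<close> \<open>0 < e\<close> by (intro Inf_lower) auto
  qed
  then show ?thesis
    unfolding d_op_inter_def by (intro Inf_greatest) auto
qed

end
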